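(* Suppose that a graph $G$ on vertices $v_1,\dots,v_n$ has a branch that consists of a path of length $k$ whose indices are $\{i_1,i_2,\dots,i_k\}$, where $i_1$ is connected to the rest of the graph and $i_k$ is the leaf of that branch. Then for any eigenvalue $\lambda$ of the graph Laplacian $L(G)$ greater than $4$, any corresponding eigenvector $\boldsymbol{\phi}=(\phi_1,\dots,\phi_n)^{\mathsf T}$ satisfies $$|\phi_{i_{j+1}}|\le\gamma\,|\phi_{i_j}|\qquad\text{for } j=1,2,\dots,k-1,$$ where $$\gamma:=\frac{2}{\lambda-2}<1.$$ Hence $|\phi_{i_j}|\le\gamma^{j-1}|\phi_{i_1}|$ for $j=1,\dots,k$; that is, the magnitude of the components of an eigenvector corresponding to any $\lambda>4$ along such a branch decays exponentially toward its leaf with rate at least $\gamma$.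
   Context: Graphs are finite, simple, unweighted and undirected. The graph Laplacian of a graph $G$ with vertices $v_1,\dots,v_n$ is $L(G)=D(G)-A(G)$, where $D(G)=\operatorname{diag}(d(v_1),\dots,d(v_n))$ is the diagonal matrix of vertex degrees and $A(G)=(a_{ij})$ is the adjacency matrix ($a_{ij}=1$ if $v_i,v_j$ are adjacent, and $0$ otherwise). A branch consisting of a path of length $k$ with indices $i_1,\dots,i_k$ means: the $k$ distinct vertices $v_{i_1},\dots,v_{i_k}$ form a path with $v_{i_j}$ adjacent to $v_{i_{j+1}}$ for $1\le j\le k-1$, there are no other edges among them, only $v_{i_1}$ is adjacent to vertices of $G$ outside the branch, and $v_{i_k}$ is the leaf (degree-one) end of the branch. *)

theory Defs
  imports
    "Graph_Theory.Digraph"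
    "Jordan_Normal_Form.Char_Poly"
begin

text \<open>
  Finite simple graphs are the symmetric loop-free digraphs without multiple arcs of locale
  \<^locale>\<open>graph\<close>. An undirected edge is represented by two opposite arcs, so the
  degree of a vertex is its \<^const>\<open>out_degree\<close>.

  The vertices are listed by an enumeration \<open>v\<close> of \<open>verts G\<close>. As matrix and
  vector indices start at 0, it runs over \<open>{0..<n}\<close>.
\<close>

definition degree_mat :: "('a, 'b) pre_digraph \<Rightarrow> nat \<Rightarrow> (nat \<Rightarrow> 'a) \<Rightarrow> real mat" where
  "degree_mat G n v =
     mat n n (\<lambda>(r, c). if r = c then real (out_degree G (v r)) else 0)"

definition adjacency_mat :: "('a, 'b) pre_digraph \<Rightarrow> nat \<Rightarrow> (nat \<Rightarrow> 'a) \<Rightarrow> real mat" where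
  "adjacency_mat G n v =
     mat n n (\<lambda>(r, c). if v r \<rightarrow>\<^bsub>G\<^esub> v c then 1 else 0)"

definition laplacian :: "('a, 'b) pre_digraph \<Rightarrow> nat \<Rightarrow> (nat \<Rightarrow> 'a) \<Rightarrow> real mat" where
  "laplacian G n v = degree_mat G n v - adjacency_mat G n v"

text \<open>
  The vertices \<open>p 1, \<dots>, p k\<close> form a branch of \<open>G\<close> that is a path: it is attached
  to the rest of the graph at \<open>p 1\<close> only and ends in the leaf \<open>p k\<close>.
  Values of \<open>p\<close> outside \<open>{1..k}\<close> are irrelevant.
\<close>

definition path_branch :: "('a, 'b) pre_digraph \<Rightarrow> nat \<Rightarrow> (nat \<Rightarrow> 'a) \<Rightarrow> bool" where
  "path_branch G k p \<longleftrightarrow>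
     1 \<le> k \<and>
     p ` {1..k} \<subseteq> verts G \<and>
     inj_on p {1..k} \<and>
     (\<forall>a\<in>{1..k}. \<forall>b\<in>{1..k}. p a \<rightarrow>\<^bsub>G\<^esub> p b \<longleftrightarrow> b = a + 1 \<or> a = b + 1) \<and>
     (\<exists>w\<in>verts G - p ` {1..k}. p 1 \<rightarrow>\<^bsub>G\<^esub> w) \<and>
     (\<forall>j\<in>{2..k}. \<forall>w\<in>verts G - p ` {1..k}. \<not> p j \<rightarrow>\<^bsub>G\<^esub> w) \<and>
     out_degree G (p k) = 1"

end

theory Submission
  imports Defs
begin

text \<open>
  Let \<open>x j\<close> be the component of the eigenvector at the \<open>j\<close>-th vertex of the branch. The
  eigenvalue equation at a vertex involves only its neighbours, so along the branch it is a
  three-term recurrence: \<open>(lam - 2) x j = - (x (j - 1) + x (j + 1))\<close> at an inner vertex. At the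
  leaf, where the degree is 1, it has the same form if the path is prolonged by a mirror vertex
  with \<open>x (k + 1) = x k\<close>.

  Decay then travels from the leaf towards the root. If \<open>\<bar>x (j + 1)\<bar> \<le> \<bar>x j\<bar>\<close>, the recurrence gives
  \<open>(lam - 2) \<bar>x j\<bar> \<le> \<bar>x (j - 1)\<bar> + \<bar>x j\<bar>\<close>. As \<open>lam - 2 > 2\<close>, this forces
  \<open>\<bar>x j\<bar> \<le> \<bar>x (j - 1)\<bar>\<close>, whence \<open>(lam - 2) \<bar>x j\<bar> \<le> 2 \<bar>x (j - 1)\<bar>\<close>. This is the desired bound,
  and since its factor \<open>2 / (lam - 2)\<close> is below 1, it supplies the hypothesis for the vertex before.
  The mirror vertex satisfies that hypothesis trivially and starts the induction. This argument
  is \<open>recurrence_decay\<close>; \<open>laplacian_eigenvector_sum\<close> and \<open>path_branch_successors\<close> together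
  yield the recurrence.
\<close>

text \<open>
  The three-term recurrence alone also has solutions growing with \<open>j\<close>; the equation at the
  leaf excludes them. So the induction starts there and runs downwards, each bound yielding the
  one before it.
\<close>

lemma recurrence_decay:
  fixes x :: "nat \<Rightarrow> real"
  assumes lam: "lam > 4"
    and leaf: "x k - x (k - 1) = lam * x k"
    and interior: "\<And>j. 2 \<le> j \<Longrightarrow> j < k \<Longrightarrow> (x j - x (j - 1)) + (x j - x (j + 1)) = lam * x j"
    and "1 \<le> j" "j < k"
  shows "\<bar>x (j + 1)\<bar> \<le> 2 / (lam - 2) * \<bar>x j\<bar>"
proof -
  have one_step: "\<bar>a\<bar> \<le> 2 / (lam - 2) * \<bar>b\<bar>"
    if eq: "(lam - 2) * a = - (b + c)" and le: "\<bar>c\<bar> \<le> \<bar>a\<bar>" for a b c :: real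
  proof -
    have "(lam - 2) * \<bar>a\<bar> = \<bar>b + c\<bar>"
      using arg_cong[OF eq, of abs] lam by (simp add: abs_mult)
    also have "\<dots> \<le> \<bar>b\<bar> + \<bar>c\<bar>" by (rule abs_triangle_ineq)
    finally have bound: "(lam - 2) * \<bar>a\<bar> \<le> \<bar>b\<bar> + \<bar>c\<bar>" .
    moreover have "2 * \<bar>a\<bar> \<le> (lam - 2) * \<bar>a\<bar>"
      using lam by (intro mult_right_mono) auto
    \<comment> \<open>With \<open>\<bar>c\<bar> \<le> \<bar>a\<bar>\<close> this gives \<open>\<bar>a\<bar> \<le> \<bar>b\<bar>\<close>, hence \<open>\<bar>c\<bar> \<le> \<bar>b\<bar>\<close>.\<close>
    ultimately have "(lam - 2) * \<bar>a\<bar> \<le> 2 * \<bar>b\<bar>" using le by linarith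
    then show ?thesis using lam by (simp add: field_simps)
  qed
  have contract: "2 / (lam - 2) * \<bar>b\<bar> \<le> \<bar>b\<bar>" for b :: real
    using lam by (intro mult_left_le_one_le) auto
  have "j \<le> k - 1" using \<open>j < k\<close> by simp
  then show ?thesis using \<open>1 \<le> j\<close>
  proof (induction rule: inc_induct)
    case base
    then have "Suc (k - 1) = k" by simp
    \<comment> \<open>The mirror vertex beyond the leaf carries the value \<open>x k\<close>.\<close>
    moreover have "(lam - 2) * x k = - (x (k - 1) + x k)"
      using leaf by (simp add: algebra_simps)
    ultimately show ?case using one_step by simp
  next
    case (step j)
    have "(lam - 2) * x (j + 1) = - (x j + x (j + 2))"
      using interior[of "j + 1"] step.hyps step.prems by (simp add: algebra_simps)
    moreover have "\<bar>x (j + 2)\<bar> \<le> \<bar>x (j + 1)\<bar>"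
      using step.IH contract[of "x (j + 1)"] by simp
    ultimately show ?case using one_step by (simp add: numeral_2_eq_2)
  qed
qed

lemma (in nomulti_digraph) out_degree_eq_card_successors:
  "out_degree G u = card {w. u \<rightarrow>\<^bsub>G\<^esub> w}"
proof -
  have "bij_betw (head G) (out_arcs G u) {w. u \<rightarrow>\<^bsub>G\<^esub> w}"
    unfolding bij_betw_def
  proof
    show "inj_on (head G) (out_arcs G u)"
      by (rule inj_onI) (auto simp: arc_to_ends_def intro: no_multi_arcs)
    show "head G ` out_arcs G u = {w. u \<rightarrow>\<^bsub>G\<^esub> w}"
      by (force simp: arcs_ends_def arc_to_ends_def)
  qed
  then show ?thesis
    unfolding out_degree_def by (rule bij_betw_same_card)
qed

text \<open>
  The diagonal entry of the Laplacian counts the neighbours, so each neighbour contributes one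
  difference. In this form the equation shows no degrees: along a branch only the set of
  neighbours has to be known.
\<close>

lemma (in nomulti_digraph) laplacian_eigenvector_sum:
  fixes lam :: real
  assumes v: "bij_betw v {0..<n} (verts G)"
    and ev: "eigenvector (laplacian G n v) \<phi> lam" and "r < n"
  shows "(\<Sum>c | c < n \<and> v r \<rightarrow>\<^bsub>G\<^esub> v c. \<phi> $ r - \<phi> $ c) = lam * \<phi> $ r"
proof -
  define N where "N = {c. c < n \<and> v r \<rightarrow>\<^bsub>G\<^esub> v c}"
  have [simp]: "finite N" unfolding N_def by simp
  have carr: "\<phi> \<in> carrier_vec n"
    and eq: "laplacian G n v *\<^sub>v \<phi> = lam \<cdot>\<^sub>v \<phi>"
    using ev by (auto simp: eigenvector_def laplacian_def adjacency_mat_def degree_mat_def)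
  have "bij_betw v N {w. v r \<rightarrow>\<^bsub>G\<^esub> w}"
    unfolding bij_betw_def
  proof
    show "inj_on v N"
      using v by (auto simp: N_def bij_betw_def intro: inj_on_subset)
    show "v ` N = {w. v r \<rightarrow>\<^bsub>G\<^esub> w}"
      using v adj_in_verts(2) by (fastforce simp: N_def bij_betw_def)
  qed
  then have deg: "out_degree G (v r) = card N"
    by (simp add: out_degree_eq_card_successors bij_betw_same_card)
  have "lam * \<phi> $ r = (laplacian G n v *\<^sub>v \<phi>) $ r"
    using eq carr \<open>r < n\<close> by simp
  also have "\<dots> = (\<Sum>c<n. ((if r = c then real (card N) else 0) - (if c \<in> N then 1 else 0)) * \<phi> $ c)"
    using carr \<open>r < n\<close>
    by (auto simp: laplacian_def degree_mat_def adjacency_mat_def scalar_prod_def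
        deg N_def atLeast0LessThan intro!: sum.cong)
  also have "\<dots> = real (card N) * \<phi> $ r - (\<Sum>c\<in>N. \<phi> $ c)"
  proof -
    have "(\<Sum>c<n. (if r = c then real (card N) else 0) * \<phi> $ c) = real (card N) * \<phi> $ r"
      using \<open>r < n\<close> by (simp add: if_distribR sum.delta' if_distrib[of "\<lambda>a. a * _"] cong: if_cong)
    moreover have "(\<Sum>c<n. (if c \<in> N then 1 else 0) * \<phi> $ c) = (\<Sum>c\<in>N. \<phi> $ c)"
      by (rule sum.mono_neutral_cong_right) (auto simp: N_def)
    ultimately show ?thesis by (simp add: left_diff_distrib sum_subtractf)
  qed
  also have "\<dots> = (\<Sum>c\<in>N. \<phi> $ r - \<phi> $ c)" by (simp add: sum_subtractf)
  finally show ?thesis by (simp add: N_def)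
qed

lemma (in wf_digraph) path_branch_successors:
  assumes pb: "path_branch G k p" and j: "2 \<le> j" "j \<le> k"
  shows "p j \<rightarrow>\<^bsub>G\<^esub> w \<longleftrightarrow> w = p (j - 1) \<or> (j < k \<and> w = p (j + 1))"
proof -
  have adj: "p j \<rightarrow>\<^bsub>G\<^esub> p b \<longleftrightarrow> b = j + 1 \<or> j = b + 1" if "b \<in> {1..k}" for b
    using pb j that unfolding path_branch_def by simp
  have sub: "w \<in> p ` {1..k}" if "p j \<rightarrow>\<^bsub>G\<^esub> w"
    using pb j that adj_in_verts(2)[OF that] unfolding path_branch_def by auto
  show ?thesis
  proof
    assume w: "p j \<rightarrow>\<^bsub>G\<^esub> w"
    with sub obtain b where b: "b \<in> {1..k}" "w = p b" by blast
    then show "w = p (j - 1) \<or> (j < k \<and> w = p (j + 1))"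
      using w adj[OF b(1)] by auto
  next
    assume "w = p (j - 1) \<or> (j < k \<and> w = p (j + 1))"
    then show "p j \<rightarrow>\<^bsub>G\<^esub> w"
    proof (elim disjE conjE)
      assume "w = p (j - 1)"
      moreover have "j - 1 \<in> {1..k}" "j = (j - 1) + 1" using j by auto
      ultimately show ?thesis using adj by blast
    next
      assume "j < k" "w = p (j + 1)"
      then show ?thesis using adj[of "j + 1"] by simp
    qed
  qed
qed

theorem theorem4p2:
  fixes G :: "('a, 'b) pre_digraph"
    and n k :: nat
    and v :: "nat \<Rightarrow> 'a"
    and i :: "nat \<Rightarrow> nat"
    and lam :: real
    and \<phi> :: "real vec"
  assumes "graph G"
    and "bij_betw v {0..<n} (verts G)"
    and "\<forall>j\<in>{1..k}. i j < n"
    and "path_branch G k (\<lambda>j. v (i j))"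
    and "eigenvalue (laplacian G n v) lam"
    and "lam > 4"
    and "eigenvector (laplacian G n v) \<phi> lam"
  shows "let \<gamma> = 2 / (lam - 2) in
    \<gamma> < 1 \<and>
    (\<forall>j. 1 \<le> j \<and> j + 1 \<le> k \<longrightarrow> \<bar>\<phi> $ i (j + 1)\<bar> \<le> \<gamma> * \<bar>\<phi> $ i j\<bar>) \<and>
    (\<forall>j\<in>{1..k}. \<bar>\<phi> $ i j\<bar> \<le> \<gamma> ^ (j - 1) * \<bar>\<phi> $ i 1\<bar>)"
proof -
  interpret graph G by fact
  define \<gamma> where "\<gamma> = 2 / (lam - 2)"
  let ?N = "\<lambda>j. {c. c < n \<and> v (i j) \<rightarrow>\<^bsub>G\<^esub> v c}"
  have \<gamma>: "0 \<le> \<gamma>" "\<gamma> < 1" using \<open>lam > 4\<close> by (simp_all add: \<gamma>_def)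
  have inj: "c = d" if "v c = v d" "c < n" "d < n" for c d
    using that assms(2) by (auto simp: bij_betw_def inj_on_def)
  have lt: "i j < n" if "1 \<le> j" "j \<le> k" for j using assms(3) that by simp
  have eigen: "(\<Sum>c\<in>?N j. \<phi> $ i j - \<phi> $ c) = lam * \<phi> $ i j" if "1 \<le> j" "j \<le> k" for j
    using laplacian_eigenvector_sum[OF assms(2,7) lt[OF that]] .
  have nbrs: "c \<in> ?N j \<longleftrightarrow> c = i (j - 1) \<or> (j < k \<and> c = i (j + 1))"
    if "2 \<le> j" "j \<le> k" for j c
    using path_branch_successors[OF assms(4) that, of "v c"] that
    by (auto intro: lt dest: inj[OF _ _ lt])
  have interior: "(\<phi> $ i j - \<phi> $ i (j - 1)) + (\<phi> $ i j - \<phi> $ i (j + 1)) = lam * \<phi> $ i j"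
    if "2 \<le> j" "j < k" for j
  proof -
    have "?N j = {i (j - 1), i (j + 1)}"
      using that nbrs[of j] by auto
    moreover have "i (j - 1) \<noteq> i (j + 1)"
    proof
      assume "i (j - 1) = i (j + 1)"
      moreover have "inj_on (\<lambda>j. v (i j)) {1..k}" using assms(4) by (simp add: path_branch_def)
      ultimately have "j - 1 = j + 1" using that by (auto dest!: inj_onD[of _ _ "j - 1" "j + 1"])
      then show False by simp
    qed
    ultimately show ?thesis using eigen[of j] that by simp
  qed
  have decay: "\<bar>\<phi> $ i (j + 1)\<bar> \<le> \<gamma> * \<bar>\<phi> $ i j\<bar>" if "1 \<le> j" "j + 1 \<le> k" for j
  proof -
    have "?N k = {i (k - 1)}" using that nbrs[of k] by auto
    then have "\<phi> $ i k - \<phi> $ i (k - 1) = lam * \<phi> $ i k"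
      using eigen[of k] that by simp
    then show ?thesis unfolding \<gamma>_def
      using recurrence_decay[of lam "\<lambda>j. \<phi> $ i j" k j] interior \<open>lam > 4\<close> that by simp
  qed
  have power: "\<bar>\<phi> $ i j\<bar> \<le> \<gamma> ^ (j - 1) * \<bar>\<phi> $ i 1\<bar>" if "1 \<le> j" "j \<le> k" for j
    using that
  proof (induction j rule: dec_induct)
    case base
    show ?case by simp
  next
    case (step j)
    have "\<bar>\<phi> $ i (Suc j)\<bar> \<le> \<gamma> * \<bar>\<phi> $ i j\<bar>" using decay[of j] step by simp
    also have "\<dots> \<le> \<gamma> * (\<gamma> ^ (j - 1) * \<bar>\<phi> $ i 1\<bar>)"
      using step \<gamma> by (intro mult_left_mono) auto
    also have "\<dots> = \<gamma> ^ (Suc j - 1) * \<bar>\<phi> $ i 1\<bar>"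
      using step.hyps by (cases j) auto
    finally show ?case .
  qed
  show ?thesis
    using \<gamma> decay power by (simp add: Let_def flip: \<gamma>_def)
qed

end
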